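(* For every strictly positive non-atomic measure $\mu$ on the Cantor algebra $\mathfrak{A}_c$, the $\mu$-Jordan extension algebra $(\mathcal{J}_\mu,\widehat{\mu})$ is metrically isomorphic to the Jordan algebra with the Lebesgue measure, $(\mathcal{J},\widehat{\lambda})$.
   Context: A measure on a Boolean algebra is a finitely additive non-negative function with value $1$ at the unit; it is non-atomic if for every $\varepsilon>0$ there is a finite partition of unity into elements of measure at most $\varepsilon$. $\mathfrak{A}_c$ is the algebra of clopen subsets of $2^\omega$ and $\mathfrak{C}$ is the Cohen algebra, the completion of $\mathfrak{A}_c$. For a measure $\mu$ on $\mathfrak{A}_c$ and $a\in\mathfrak{C}$ let $\mu_*(a)=\sup\{\mu(b):b\in\mathfrak{A}_c,\ b\le a\}$ and $\mu^*(a)=\inf\{\mu(b):b\in\mathfrak{A}_c,\ a\le b\}$. Then $\mathcal{J}_\mu=\{a\in\mathfrak{C}:\mu_*(a)=\mu^*(a)\}$, and $\widehat{\mu}(a)=\mu_*(a)=\mu^*(a)$ for $a\in\mathcal{J}_\mu$ is the unique extension of $\mu$ to $\mathcal{J}_\mu$. $\lambda$ is the Lebesgue measure on $\mathfrak{A}_c$, $\lambda([s])=2^{-n}$ for $s\in2^n$, where $[s]=\{x\in2^\omega:x\text{ extends }s\}$; the Jordan algebra is $\mathcal{J}=\mathcal{J}_\lambda$. A metric isomorphism is a measure-preserving Boolean isomorphism (only finitary operations need be preserved). *)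

theory Defs
  imports "HOL-Probability.Probability"
begin

section \<open>Measures on Boolean algebras and metric isomorphisms\<close>

definition fin_add_measure :: "('a::boolean_algebra \<Rightarrow> real) \<Rightarrow> bool" where
  "fin_add_measure m \<longleftrightarrow>
     (\<forall>a. 0 \<le> m a) \<and> m \<top> = 1 \<and> (\<forall>a b. a \<sqinter> b = \<bottom> \<longrightarrow> m (a \<squnion> b) = m a + m b)"

definition strictly_positive :: "('a::boolean_algebra \<Rightarrow> real) \<Rightarrow> bool" where
  "strictly_positive m \<longleftrightarrow> (\<forall>a. a \<noteq> \<bottom> \<longrightarrow> 0 < m a)"

definition finite_partition_of_unity :: "('a::boolean_algebra) set \<Rightarrow> bool" where
  "finite_partition_of_unity P \<longleftrightarrow>
     finite P \<and> P \<noteq> {} \<and> \<bottom> \<notin> P \<and>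
     (\<forall>a\<in>P. \<forall>b\<in>P. a \<noteq> b \<longrightarrow> a \<sqinter> b = \<bottom>) \<and> \<Squnion>\<^sub>f\<^sub>i\<^sub>n P = \<top>"

definition non_atomic :: "('a::boolean_algebra \<Rightarrow> real) \<Rightarrow> bool" where
  "non_atomic m \<longleftrightarrow>
     (\<forall>\<epsilon>>0. \<exists>P. finite_partition_of_unity P \<and> (\<forall>a\<in>P. m a \<le> \<epsilon>))"

definition subalgebra_of_ba :: "('a::boolean_algebra) set \<Rightarrow> bool" where
  "subalgebra_of_ba A \<longleftrightarrow>
     \<bottom> \<in> A \<and> \<top> \<in> A \<and> (\<forall>a\<in>A. - a \<in> A) \<and>
     (\<forall>a\<in>A. \<forall>b\<in>A. a \<sqinter> b \<in> A \<and> a \<squnion> b \<in> A)"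

definition boolean_isomorphism ::
  "('a::boolean_algebra) set \<Rightarrow> ('b::boolean_algebra) set \<Rightarrow> ('a \<Rightarrow> 'b) \<Rightarrow> bool" where
  "boolean_isomorphism A B f \<longleftrightarrow>
     subalgebra_of_ba A \<and> subalgebra_of_ba B \<and> bij_betw f A B \<and>
     f \<bottom> = \<bottom> \<and> f \<top> = \<top> \<and> (\<forall>a\<in>A. f (- a) = - f a) \<and>
     (\<forall>a\<in>A. \<forall>b\<in>A. f (a \<sqinter> b) = f a \<sqinter> f b \<and> f (a \<squnion> b) = f a \<squnion> f b)"

definition metrically_isomorphic ::
  "('a::boolean_algebra) set \<Rightarrow> ('a \<Rightarrow> real) \<Rightarrow> ('b::boolean_algebra) set \<Rightarrow> ('b \<Rightarrow> real) \<Rightarrow> bool"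
  where
  "metrically_isomorphic A m B n \<longleftrightarrow>
     (\<exists>f. boolean_isomorphism A B f \<and> (\<forall>a\<in>A. n (f a) = m a))"


section \<open>The Cantor algebra\<close>

text \<open>The Cantor space is the type \<^typ>\<open>nat \<Rightarrow> bool\<close> with the product topology.\<close>

typedef cantor_alg = "{A :: (nat \<Rightarrow> bool) set. open A \<and> closed A}"
  morphisms clopen_set Clopen
  by (rule exI[of _ "{}"]) simp

setup_lifting type_definition_cantor_alg

instantiation cantor_alg :: boolean_algebra
begin

lift_definition less_eq_cantor_alg :: "cantor_alg \<Rightarrow> cantor_alg \<Rightarrow> bool" is "(\<subseteq>)" .
lift_definition less_cantor_alg :: "cantor_alg \<Rightarrow> cantor_alg \<Rightarrow> bool" is "(\<subset>)" .
lift_definition inf_cantor_alg :: "cantor_alg \<Rightarrow> cantor_alg \<Rightarrow> cantor_alg" is "(\<inter>)" by auto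
lift_definition sup_cantor_alg :: "cantor_alg \<Rightarrow> cantor_alg \<Rightarrow> cantor_alg" is "(\<union>)" by auto
lift_definition bot_cantor_alg :: cantor_alg is "{}" by auto
lift_definition top_cantor_alg :: cantor_alg is "UNIV" by auto
lift_definition uminus_cantor_alg :: "cantor_alg \<Rightarrow> cantor_alg" is "\<lambda>A. - A" by auto
lift_definition minus_cantor_alg :: "cantor_alg \<Rightarrow> cantor_alg \<Rightarrow> cantor_alg" is "(-)"
  by (auto intro: open_Diff closed_Diff)

instance
  by standard (transfer; auto)+

end


section \<open>The Cohen algebra\<close>

text \<open>
  The completion of the Cantor algebra is realised in the standard way as the algebra of regular
  open subsets of the Cantor space.  The class of complete Boolean algebras of the library is
  not used, since it requires complete distributivity, which fails here.  The lemmas at the end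
  of this section confirm that this is the completion: a complete Boolean algebra in which the
  clopen sets form a dense subalgebra.
\<close>

lemma regular_open_interior_closure:
  "interior (closure (interior (closure X))) = interior (closure (X :: 'a::topological_space set))"
proof
  have "closure (interior (closure X)) \<subseteq> closure (closure X)"
    by (rule closure_mono, rule interior_subset)
  then show "interior (closure (interior (closure X))) \<subseteq> interior (closure X)"
    by (intro interior_mono) simp
  show "interior (closure X) \<subseteq> interior (closure (interior (closure X)))"
    by (simp add: interior_maximal closure_subset)
qed

typedef cohen = "{U :: (nat \<Rightarrow> bool) set. interior (closure U) = U}"
  morphisms reg_set Reg
  by (rule exI[of _ "{}"]) simp

setup_lifting type_definition_cohen

lemma regular_open_Inter:
  fixes S :: "'a::topological_space set set"
  assumes "\<And>U. U \<in> S \<Longrightarrow> interior (closure U) = U"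
  shows "interior (closure (interior (\<Inter>S))) = interior (\<Inter>S)"
proof
  have "interior (closure (interior (\<Inter>S))) \<subseteq> U" if "U \<in> S" for U
  proof -
    have "interior (\<Inter>S) \<subseteq> U" using that interior_subset by blast
    then have "interior (closure (interior (\<Inter>S))) \<subseteq> interior (closure U)"
      by (intro interior_mono closure_mono)
    then show ?thesis using assms[OF that] by simp
  qed
  then show "interior (closure (interior (\<Inter>S))) \<subseteq> interior (\<Inter>S)"
    by (simp add: interior_maximal le_Inf_iff)
  show "interior (\<Inter>S) \<subseteq> interior (closure (interior (\<Inter>S)))"
    by (simp add: interior_maximal closure_subset)
qed

lemma regular_open_Int:
  fixes U V :: "'a::topological_space set"
  assumes "interior (closure U) = U" "interior (closure V) = V"
  shows "interior (closure (U \<inter> V)) = U \<inter> V"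
proof -
  have "open U" "open V" using open_interior[of "closure U"] open_interior[of "closure V"] assms
    by simp_all
  then have "interior (U \<inter> V) = U \<inter> V" by (simp add: interior_open)
  moreover have "interior (closure (interior (\<Inter>{U, V}))) = interior (\<Inter>{U, V})"
    by (rule regular_open_Inter) (use assms in auto)
  ultimately show ?thesis by simp
qed

lemma regular_open_Compl:
  fixes U :: "'a::topological_space set"
  assumes "interior (closure U) = U"
  shows "interior (closure (interior (- U))) = interior (- U)"
  by (simp add: interior_complement closure_complement assms)

instantiation cohen :: "{boolean_algebra, complete_lattice}"
begin

lift_definition less_eq_cohen :: "cohen \<Rightarrow> cohen \<Rightarrow> bool" is "(\<subseteq>)" .
lift_definition less_cohen :: "cohen \<Rightarrow> cohen \<Rightarrow> bool" is "(\<subset>)" .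
lift_definition inf_cohen :: "cohen \<Rightarrow> cohen \<Rightarrow> cohen" is "(\<inter>)"
  by (rule regular_open_Int)
lift_definition sup_cohen :: "cohen \<Rightarrow> cohen \<Rightarrow> cohen" is "\<lambda>U V. interior (closure (U \<union> V))"
  by (rule regular_open_interior_closure)
lift_definition bot_cohen :: cohen is "{}" by simp
lift_definition top_cohen :: cohen is "UNIV" by simp
lift_definition uminus_cohen :: "cohen \<Rightarrow> cohen" is "\<lambda>U. interior (- U)"
  by (rule regular_open_Compl)
lift_definition minus_cohen :: "cohen \<Rightarrow> cohen \<Rightarrow> cohen" is "\<lambda>U V. U \<inter> interior (- V)"
  by (intro regular_open_Int regular_open_Compl)
lift_definition Inf_cohen :: "cohen set \<Rightarrow> cohen" is "\<lambda>S. interior (\<Inter>S)"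
  by (rule regular_open_Inter) auto
lift_definition Sup_cohen :: "cohen set \<Rightarrow> cohen" is "\<lambda>S. interior (closure (\<Union>S))"
  by (rule regular_open_interior_closure)

instance
proof
  fix x y z :: cohen
  have ub: "U \<subseteq> interior (closure W)"
    if "U \<subseteq> W" "interior (closure U) = U" for U W :: "(nat \<Rightarrow> bool) set"
    using interior_mono[OF closure_mono[OF that(1)]] that(2) by simp
  have lub: "interior (closure W) \<subseteq> U"
    if "W \<subseteq> U" "interior (closure U) = U" for U W :: "(nat \<Rightarrow> bool) set"
    using interior_mono[OF closure_mono[OF that(1)]] that(2) by simp
  show "(x < y) = (x \<le> y \<and> \<not> y \<le> x)" by transfer auto
  show "x \<le> x" by transfer auto
  show "x \<le> y \<Longrightarrow> y \<le> z \<Longrightarrow> x \<le> z" by transfer auto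
  show "x \<le> y \<Longrightarrow> y \<le> x \<Longrightarrow> x = y" by transfer auto
  show "x \<sqinter> y \<le> x" by transfer auto
  show "x \<sqinter> y \<le> y" by transfer auto
  show "x \<le> y \<Longrightarrow> x \<le> z \<Longrightarrow> x \<le> y \<sqinter> z" by transfer auto
  show "x \<le> x \<squnion> y" by transfer (rule ub, auto)
  show "y \<le> x \<squnion> y" by transfer (rule ub, auto)
  show "y \<le> x \<Longrightarrow> z \<le> x \<Longrightarrow> y \<squnion> z \<le> x" by transfer (rule lub, auto)
  show "\<bottom> \<le> x" by transfer auto
  show "x \<le> \<top>" by transfer auto
  show "x \<sqinter> - x = \<bottom>"
    by transfer (use interior_subset in fastforce)
  show "x \<squnion> - x = \<top>"
  proof transfer
    fix U :: "(nat \<Rightarrow> bool) set"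
    have "closure (U \<union> interior (- U)) = UNIV"
      using closure_subset[of U] closure_subset[of "- closure U"]
      by (auto simp: closure_Un interior_complement)
    then show "interior (closure (U \<union> interior (- U))) = UNIV" by simp
  qed
  show "x - y = x \<sqinter> - y" by transfer auto
  show "x \<squnion> y \<sqinter> z = (x \<squnion> y) \<sqinter> (x \<squnion> z)"
  proof transfer
    fix U V W :: "(nat \<Rightarrow> bool) set"
    assume r: "interior (closure U) = U" "interior (closure V) = V" "interior (closure W) = W"
    have op: "open U" "open V" "open W" using r open_interior by metis+
    let ?A = "interior (closure (U \<union> V))" and ?B = "interior (closure (U \<union> W))"
    have "?A \<inter> ?B \<subseteq> closure (U \<union> V \<inter> W)"
    proof
      fix p assume p: "p \<in> ?A \<inter> ?B"
      show "p \<in> closure (U \<union> V \<inter> W)"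
        unfolding closure_iff_nhds_not_empty
      proof (intro allI impI)
        fix A N assume N: "N \<subseteq> A" "open N" "p \<in> N"
        let ?N = "N \<inter> ?A \<inter> ?B"
        have oN: "open ?N" using N by auto
        have "p \<in> closure (U \<union> V)" using p interior_subset by blast
        then obtain q where q: "q \<in> ?N" "q \<in> U \<union> V"
          using oN p N unfolding closure_iff_nhds_not_empty by blast
        show "(U \<union> V \<inter> W) \<inter> A \<noteq> {}"
        proof (cases "q \<in> U")
          case True then show ?thesis using q N by auto
        next
          case False
          then have "q \<in> ?N \<inter> V" using q by auto
          moreover have "open (?N \<inter> V)" using oN op by auto
          moreover have "q \<in> closure (U \<union> W)" using q interior_subset by blast
          ultimately obtain t where "t \<in> ?N \<inter> V" "t \<in> U \<union> W"
            unfolding closure_iff_nhds_not_empty by blast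
          then show ?thesis using N by auto
        qed
      qed
    qed
    then have "?A \<inter> ?B \<subseteq> interior (closure (U \<union> V \<inter> W))"
      by (simp add: interior_maximal open_Int)
    moreover have "interior (closure (U \<union> V \<inter> W)) \<subseteq> ?A"
      by (rule interior_mono, rule closure_mono) auto
    moreover have "interior (closure (U \<union> V \<inter> W)) \<subseteq> ?B"
      by (rule interior_mono, rule closure_mono) auto
    ultimately show "interior (closure (U \<union> V \<inter> W)) = ?A \<inter> ?B" by blast
  qed
next
  fix x z :: cohen and A :: "cohen set"
  have reg: "interior (closure (reg_set y)) = reg_set y" for y
    using reg_set[of y] by simp
  show "\<Sqinter>A \<le> x" if "x \<in> A"
    using that interior_subset[of "\<Inter>(reg_set ` A)"]
    by (auto simp: less_eq_cohen.rep_eq Inf_cohen.rep_eq)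
  show "z \<le> \<Sqinter>A" if "\<And>x. x \<in> A \<Longrightarrow> z \<le> x"
  proof -
    have "open (reg_set z)" using open_interior[of "closure (reg_set z)"] reg[of z] by simp
    moreover have "reg_set z \<subseteq> \<Inter>(reg_set ` A)"
      using that by (auto simp: less_eq_cohen.rep_eq)
    ultimately show ?thesis
      by (simp add: less_eq_cohen.rep_eq Inf_cohen.rep_eq interior_maximal)
  qed
  show "x \<le> \<Squnion>A" if "x \<in> A"
  proof -
    have "reg_set x \<subseteq> \<Union>(reg_set ` A)" using that by auto
    from interior_mono[OF closure_mono[OF this]] show ?thesis
      by (simp add: less_eq_cohen.rep_eq Sup_cohen.rep_eq reg)
  qed
  show "\<Squnion>A \<le> z" if "\<And>x. x \<in> A \<Longrightarrow> x \<le> z"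
  proof -
    have "\<Union>(reg_set ` A) \<subseteq> reg_set z" using that by (auto simp: less_eq_cohen.rep_eq)
    from interior_mono[OF closure_mono[OF this]] show ?thesis
      by (simp add: less_eq_cohen.rep_eq Sup_cohen.rep_eq reg)
  qed
  show "\<Sqinter>{} = (\<top> :: cohen)" by transfer simp
  show "\<Squnion>{} = (\<bottom> :: cohen)" by transfer simp
qed

end

lift_definition cohen_of :: "cantor_alg \<Rightarrow> cohen" is "\<lambda>A. A"
  by (simp add: interior_open)

lemma cohen_of_le_iff: "cohen_of a \<le> cohen_of b \<longleftrightarrow> a \<le> b"
  by transfer simp

lemma cohen_of_inject: "cohen_of a = cohen_of b \<longleftrightarrow> a = b"
  by transfer simp

lemma cohen_of_hom:
  "cohen_of \<bottom> = \<bottom>" "cohen_of \<top> = \<top>" "cohen_of (- a) = - cohen_of a"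
  "cohen_of (a \<sqinter> b) = cohen_of a \<sqinter> cohen_of b"
  "cohen_of (a \<squnion> b) = cohen_of a \<squnion> cohen_of b"
  by (transfer; simp add: interior_open open_Compl open_Un closed_Un)+

text \<open>The basic clopen set \<open>[s]\<close> of all extensions of the finite sequence \<open>s\<close>.\<close>

definition cylinder_set :: "bool list \<Rightarrow> (nat \<Rightarrow> bool) set" where
  "cylinder_set s = {x. \<forall>i<length s. x i = s ! i}"

lemma cylinder_set_PiE:
  "cylinder_set s = Pi\<^sub>E UNIV (\<lambda>i. if i < length s then {s ! i} else UNIV)"
  by (auto simp: cylinder_set_def PiE_def Pi_def split: if_splits)

lemma clopen_cylinder_set: "open (cylinder_set s) \<and> closed (cylinder_set s)"
proof
  have "finite {i. (if i < length s then {s ! i} else UNIV) \<noteq> UNIV}"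
    by (rule finite_subset[of _ "{..<length s}"]) auto
  then show "open (cylinder_set s)"
    unfolding cylinder_set_PiE by (intro open_PiE) (simp_all add: discrete_topology_class.open_discrete)
  have "cylinder_set s = (\<Inter>i\<in>{..<length s}. (\<lambda>x. x i) -` {s ! i})"
    by (auto simp: cylinder_set_def)
  moreover have "closed ((\<lambda>x::nat \<Rightarrow> bool. x i) -` {s ! i})" for i
    by (intro closed_vimage closed_singleton continuous_on_product_coordinates)
  ultimately show "closed (cylinder_set s)" by auto
qed

lift_definition cylinder :: "bool list \<Rightarrow> cantor_alg" is cylinder_set
  by (rule clopen_cylinder_set)

lemma cohen_of_dense:
  assumes "u \<noteq> \<bottom>"
  obtains a where "a \<noteq> \<bottom>" "cohen_of a \<le> u"
proof -
  have "\<exists>s. cohen_of (cylinder s) \<le> u"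
    using assms
  proof transfer
    fix U :: "(nat \<Rightarrow> bool) set"
    assume r: "interior (closure U) = U" and "U \<noteq> {}"
    then obtain x where x: "x \<in> U" by auto
    have "open U" using open_interior[of "closure U"] r by simp
    then have oU: "openin (product_topology (\<lambda>_. euclidean) UNIV) U" by (simp only: open_fun_def)
    obtain X where X: "x \<in> Pi\<^sub>E UNIV X" "finite {i. X i \<noteq> UNIV}" "Pi\<^sub>E UNIV X \<subseteq> U"
      using product_topology_open_contains_basis[OF oU x] by (simp only: topspace_euclidean) blast
    obtain n where n: "\<And>i. X i \<noteq> UNIV \<Longrightarrow> i < n"
      using X(2) unfolding finite_nat_set_iff_bounded by blast
    have "cylinder_set (map x [0..<n]) \<subseteq> Pi\<^sub>E UNIV X"
    proof
      fix y assume "y \<in> cylinder_set (map x [0..<n])"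
      then have y: "y i = x i" if "i < n" for i using that by (simp add: cylinder_set_def)
      have "y i \<in> X i" for i
        using n[of i] y[of i] PiE_mem[OF X(1), of i] by (cases "X i = UNIV") simp_all
      then show "y \<in> Pi\<^sub>E UNIV X" by (simp add: PiE_UNIV_domain)
    qed
    then show "\<exists>s. cylinder_set s \<subseteq> U" using X(3) by blast
  qed
  then obtain s where "cohen_of (cylinder s) \<le> u" by auto
  moreover have "cylinder s \<noteq> \<bottom>"
  proof transfer
    fix s
    have "(\<lambda>i. s ! i) \<in> cylinder_set s" by (simp add: cylinder_set_def)
    then show "cylinder_set s \<noteq> {}" by blast
  qed
  ultimately show thesis using that by blast
qed


section \<open>Jordan extensions\<close>

definition inner_ext :: "(cantor_alg \<Rightarrow> real) \<Rightarrow> cohen \<Rightarrow> real" where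
  "inner_ext \<mu> a = Sup {\<mu> b | b. cohen_of b \<le> a}"

definition outer_ext :: "(cantor_alg \<Rightarrow> real) \<Rightarrow> cohen \<Rightarrow> real" where
  "outer_ext \<mu> a = Inf {\<mu> b | b. a \<le> cohen_of b}"

definition jordan_alg :: "(cantor_alg \<Rightarrow> real) \<Rightarrow> cohen set" where
  "jordan_alg \<mu> = {a. inner_ext \<mu> a = outer_ext \<mu> a}"

text \<open>Only meaningful on \<^term>\<open>jordan_alg \<mu>\<close>, where inner and outer extension coincide.\<close>

definition jordan_ext :: "(cantor_alg \<Rightarrow> real) \<Rightarrow> cohen \<Rightarrow> real" where
  "jordan_ext \<mu> a = inner_ext \<mu> a"


section \<open>The Lebesgue measure on the Cantor algebra\<close>

abbreviation coin_space :: "(nat \<Rightarrow> bool) measure" where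
  "coin_space \<equiv> Pi\<^sub>M UNIV (\<lambda>_. uniform_count_measure UNIV)"

definition lebesgue_cantor :: "cantor_alg \<Rightarrow> real" where
  "lebesgue_cantor a = measure coin_space (clopen_set a)"

instance bool :: second_countable_topology
proof
  have "(open :: bool set \<Rightarrow> bool) = generate_topology UNIV"
    by (simp add: fun_eq_iff discrete_topology_class.open_discrete generate_topology.Basis)
  then show "\<exists>B :: bool set set. countable B \<and> open = generate_topology B"
    by (metis countableI_type)
qed

lemma prob_space_coin: "prob_space (uniform_count_measure (UNIV :: bool set))"
  by (rule prob_space_uniform_count_measure) auto

lemma sets_coin_space: "sets coin_space = sets borel"
proof -
  have "sets coin_space = sets (Pi\<^sub>M UNIV (\<lambda>_::nat. borel :: bool measure))"
    by (intro sets_PiM_cong) (auto simp: sets_uniform_count_measure sets_borel_eq_count_space)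
  then show ?thesis by (simp add: sets_PiM_equal_borel)
qed

lemma lebesgue_cantor_cylinder: "lebesgue_cantor (cylinder s) = (1/2) ^ length s"
proof -
  let ?M = "\<lambda>_::nat. uniform_count_measure (UNIV :: bool set)"
  interpret product_prob_space ?M UNIV
    by (intro product_prob_spaceI prob_space_coin)
  have "cylinder_set s =
      prod_emb UNIV ?M {..<length s} (Pi\<^sub>E {..<length s} (\<lambda>i. {s ! i}))"
    by (auto simp: cylinder_set_def prod_emb_def space_uniform_count_measure PiE_def Pi_def)
  then show ?thesis
    unfolding lebesgue_cantor_def cylinder.rep_eq
    by (simp only:, subst measure_PiM_emb)
       (auto simp: sets_uniform_count_measure measure_uniform_count_measure power_divide)
qed

lemma fin_add_measure_lebesgue_cantor: "fin_add_measure lebesgue_cantor"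
proof -
  interpret prob_space coin_space
    by (intro prob_space_PiM prob_space_coin)
  have sp: "space coin_space = UNIV"
    by (auto simp: space_PiM space_uniform_count_measure)
  have m: "clopen_set a \<in> sets coin_space" for a
    using clopen_set[of a] by (simp add: sets_coin_space)
  have "lebesgue_cantor (a \<squnion> b) = lebesgue_cantor a + lebesgue_cantor b"
    if "a \<sqinter> b = \<bottom>" for a b
  proof -
    have "clopen_set a \<inter> clopen_set b = {}"
      using that by (metis bot_cantor_alg.rep_eq inf_cantor_alg.rep_eq)
    then show ?thesis
      unfolding lebesgue_cantor_def sup_cantor_alg.rep_eq
      by (intro finite_measure_Union m)
  qed
  moreover have "lebesgue_cantor \<top> = 1"
    using prob_space by (simp add: lebesgue_cantor_def top_cantor_alg.rep_eq sp)
  ultimately show ?thesis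
    by (auto simp: fin_add_measure_def lebesgue_cantor_def)
qed

end

theory Submission
  imports Defs
begin

text \<open>
  Order the Cantor space lexicographically and let \<open>quantile \<mu> t\<close> be the point at which the
  distribution function of \<open>\<mu>\<close> reaches \<open>t\<close>.  The preimage of a cylinder under
  \<open>quantile \<mu> : [0,1) \<rightarrow> 2\<^sup>\<omega>\<close> is a half-open interval of length equal to the measure of the cylinder,
  so clopen sets become finite unions of intervals, and non-atomicity makes these approximate every
  interval.  Hence an element of the \<open>\<mu>\<close>-Jordan algebra and a Jordan measurable subset of \<open>[0,1)\<close>
  can be matched whenever they are squeezed by the same clopen sets.  Which subsets of \<open>[0,1)\<close> are
  matched does not depend on \<open>\<mu>\<close>, and by strict positivity two elements matched with sets that
  differ by a null set coincide.  Composing the matchings for \<open>\<mu>\<close> and \<open>\<lambda>\<close> gives the isomorphism.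
\<close>

section \<open>Finitely additive measures and Boolean isomorphisms\<close>

context
  fixes m :: "'a::boolean_algebra \<Rightarrow> real"
  assumes m: "fin_add_measure m"
begin

lemma fin_add_measure_nonneg: "0 \<le> m a"
  and fin_add_measure_top: "m \<top> = 1"
  and fin_add_measure_Un: "a \<sqinter> b = \<bottom> \<Longrightarrow> m (a \<squnion> b) = m a + m b"
  using m unfolding fin_add_measure_def by auto

lemma fin_add_measure_bot: "m \<bottom> = 0"
  using fin_add_measure_Un[of \<bottom> \<bottom>] by simp

lemma fin_add_measure_diff:
  assumes "a \<le> b"
  shows "m (b \<sqinter> - a) = m b - m a"
proof -
  have "a \<squnion> (b \<sqinter> - a) = b"
    using assms by (simp add: sup_inf_distrib1 sup.absorb2)
  moreover have "a \<sqinter> (b \<sqinter> - a) = \<bottom>"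
    by (metis inf.left_commute inf_bot_right inf_compl_bot)
  ultimately show ?thesis
    using fin_add_measure_Un[of a "b \<sqinter> - a"] by simp
qed

lemma fin_add_measure_mono: "a \<le> b \<Longrightarrow> m a \<le> m b"
  using fin_add_measure_diff[of a b] fin_add_measure_nonneg[of "b \<sqinter> - a"] by simp

lemma fin_add_measure_compl: "m (- a) = 1 - m a"
  using fin_add_measure_diff[of a \<top>] by (simp add: fin_add_measure_top)

lemma fin_add_measure_subadd: "m (a \<squnion> b) \<le> m a + m b"
proof -
  have "a \<squnion> b = a \<squnion> (b \<sqinter> - a)"
    by (simp add: sup_inf_distrib1)
  moreover have "a \<sqinter> (b \<sqinter> - a) = \<bottom>"
    by (metis inf.left_commute inf_bot_right inf_compl_bot)
  ultimately have "m (a \<squnion> b) = m a + m (b \<sqinter> - a)"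
    using fin_add_measure_Un by metis
  then show ?thesis
    using fin_add_measure_mono[of "b \<sqinter> - a" b] by simp
qed

text \<open>Whatever lies in \<open>u \<sqinter> u'\<close> but not in
  \<open>l \<sqinter> l'\<close> escapes \<open>l\<close> or \<open>l'\<close>, so it is covered by
  the two individual gaps. This keeps approximation errors under control when bounds are
  intersected.\<close>

lemma fin_add_measure_inf_gap:
  assumes "l \<le> u" "l' \<le> u'"
  shows "m (u \<sqinter> u') - m (l \<sqinter> l') \<le> (m u - m l) + (m u' - m l')"
proof -
  have "m (u \<sqinter> u') - m (l \<sqinter> l') = m ((u \<sqinter> u') \<sqinter> - (l \<sqinter> l'))"
    by (rule fin_add_measure_diff[symmetric]) (use assms in \<open>simp add: le_infI1 le_infI2\<close>)
  also have "\<dots> \<le> m ((u \<sqinter> - l) \<squnion> (u' \<sqinter> - l'))"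
    by (rule fin_add_measure_mono)
      (simp add: inf_sup_distrib1 le_supI1[OF inf_mono[OF inf_le1 order_refl]]
        le_supI2[OF inf_mono[OF inf_le2 order_refl]])
  also have "\<dots> \<le> m (u \<sqinter> - l) + m (u' \<sqinter> - l')"
    by (rule fin_add_measure_subadd)
  finally show ?thesis
    using assms by (simp add: fin_add_measure_diff)
qed

end

text \<open>A relation compatible with complements and meets is single-valued and injective as soon
  as \<bottom> is related only to \<bottom>: from \<open>S x y\<close> and \<open>S x y'\<close>
  follows \<open>S \<bottom> (y \<sqinter> - y')\<close>, hence \<open>y \<le> y'\<close>, and
  symmetrically. An isomorphism can therefore be given as a relation, without choosing images
  explicitly.\<close>

lemma metrically_isomorphicI_rel:
  fixes S :: "'a::boolean_algebra \<Rightarrow> 'b::boolean_algebra \<Rightarrow> bool"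
  assumes dom: "\<And>x y. S x y \<Longrightarrow> x \<in> A \<and> y \<in> B \<and> n y = m x"
    and left_total: "\<And>x. x \<in> A \<Longrightarrow> \<exists>y. S x y"
    and right_total: "\<And>y. y \<in> B \<Longrightarrow> \<exists>x. S x y"
    and bot: "S \<bottom> \<bottom>" "\<And>y. S \<bottom> y \<Longrightarrow> y = \<bottom>" "\<And>x. S x \<bottom> \<Longrightarrow> x = \<bottom>"
    and compl: "\<And>x y. S x y \<Longrightarrow> S (- x) (- y)"
    and inf: "\<And>x y x' y'. S x y \<Longrightarrow> S x' y' \<Longrightarrow> S (x \<sqinter> x') (y \<sqinter> y')"
  shows "metrically_isomorphic A m B n"
proof -
  have sup: "S (x \<squnion> x') (y \<squnion> y')" if "S x y" "S x' y'" for x y x' y'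
    using compl[OF inf[OF compl[OF that(1)] compl[OF that(2)]]] by simp
  have top: "S \<top> \<top>"
    using compl[OF bot(1)] by simp
  have le_right: "y \<le> y'" if "S x y" "S x y'" for x y y'
    using bot(2)[of "y \<sqinter> - y'"] inf[OF that(1) compl[OF that(2)]] by (simp add: inf_shunt)
  have le_left: "x \<le> x'" if "S x y" "S x' y" for x x' y
    using bot(3)[of "x \<sqinter> - x'"] inf[OF that(1) compl[OF that(2)]] by (simp add: inf_shunt)
  define f where "f x = (SOME y. S x y)" for x
  have S_f: "S x (f x)" if "x \<in> A" for x
    unfolding f_def using left_total[OF that] by (rule someI_ex)
  have f_eq: "f x = y" if "S x y" for x y
    using le_right that S_f dom by (meson antisym)
  have "bij_betw f A B"
  proof (rule bij_betwI')
    show "(f x = f y) = (x = y)" if "x \<in> A" "y \<in> A" for x y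
      using S_f[OF that(1)] S_f[OF that(2)] le_left by (metis antisym)
    show "f x \<in> B" if "x \<in> A" for x
      using S_f[OF that] dom by blast
    show "\<exists>x\<in>A. y = f x" if "y \<in> B" for y
      using right_total[OF that] f_eq dom by metis
  qed
  moreover have "subalgebra_of_ba A"
    unfolding subalgebra_of_ba_def using bot(1) top dom S_f compl inf sup by meson
  moreover have "subalgebra_of_ba B"
    unfolding subalgebra_of_ba_def using bot(1) top dom right_total compl inf sup by meson
  moreover have "f \<bottom> = \<bottom>" "f \<top> = \<top>" "\<forall>a\<in>A. f (- a) = - f a"
    "\<forall>a\<in>A. \<forall>b\<in>A. f (a \<sqinter> b) = f a \<sqinter> f b \<and> f (a \<squnion> b) = f a \<squnion> f b"
    using f_eq bot(1) top S_f compl inf sup by simp_all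
  ultimately have "boolean_isomorphism A B f"
    unfolding boolean_isomorphism_def by blast
  then show ?thesis
    unfolding metrically_isomorphic_def using dom S_f by blast
qed

section \<open>Cylinders\<close>

lemma mem_cylinder_set_iff: "x \<in> cylinder_set s \<longleftrightarrow> map x [0..<length s] = s"
  by (simp add: cylinder_set_def list_eq_iff_nth_eq[of _ s])

lemma cylinder_set_snoc:
  "cylinder_set (s @ [b]) = {x \<in> cylinder_set s. x (length s) = b}"
  by (auto simp: cylinder_set_def nth_append less_Suc_eq)

lemma cylinder_Nil: "cylinder [] = \<top>"
  by transfer (simp add: cylinder_set_def)

lemma cylinder_split: "cylinder s = cylinder (s @ [False]) \<squnion> cylinder (s @ [True])"
  by transfer (auto simp: cylinder_set_snoc)

lemma cylinder_split_disjoint: "cylinder (s @ [False]) \<sqinter> cylinder (s @ [True]) = \<bottom>"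
  by transfer (auto simp: cylinder_set_snoc)

text \<open>A basic open box constrains only finitely many coordinates, so fixing all coordinates
  below a common bound keeps a point inside it.\<close>

lemma open_contains_cylinder_set:
  assumes "open U" "x \<in> U"
  obtains n where "cylinder_set (map x [0..<n]) \<subseteq> U"
proof -
  have "openin (product_topology (\<lambda>_. euclidean) UNIV) U"
    using assms(1) by (simp only: open_fun_def)
  from product_topology_open_contains_basis[OF this assms(2)]
  obtain X where X: "x \<in> Pi\<^sub>E UNIV X" "finite {i. X i \<noteq> UNIV}" "Pi\<^sub>E UNIV X \<subseteq> U"
    by (simp only: topspace_euclidean) blast
  obtain n where n: "\<And>i. X i \<noteq> UNIV \<Longrightarrow> i < n"
    using X(2) unfolding finite_nat_set_iff_bounded by blast
  have "y \<in> Pi\<^sub>E UNIV X" if "y \<in> cylinder_set (map x [0..<n])" for y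
  proof -
    have y: "y i = x i" if "i < n" for i
      using \<open>y \<in> cylinder_set (map x [0..<n])\<close> that by (simp add: cylinder_set_def)
    have "y i \<in> X i" for i
      using n[of i] y[of i] PiE_mem[OF X(1), of i] by (cases "X i = UNIV") simp_all
    then show ?thesis by (simp add: PiE_UNIV_domain)
  qed
  then have "cylinder_set (map x [0..<n]) \<subseteq> U"
    using X(3) by blast
  then show thesis by (rule that)
qed

text \<open>Bar induction on the binary tree, playing the role of compactness: if \<open>P\<close>
  failed at the root, \<open>step\<close> would pass the failure on to a child forever, producing an
  infinite branch that contradicts \<open>bar\<close>.\<close>

lemma bool_list_bar_induct:
  assumes bar: "\<And>x. \<exists>n. P (map x [0..<n])"
    and step: "\<And>s. P (s @ [False]) \<Longrightarrow> P (s @ [True]) \<Longrightarrow> P s"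
  shows "P []"
proof (rule ccontr)
  assume neg: "\<not> P []"
  \<comment> \<open>The branch turns left unless \<open>P\<close> holds at the left child; in that
    case \<open>step\<close> forces \<open>P\<close> to fail at the right child.\<close>
  define p where "p = rec_nat [] (\<lambda>_ s. s @ [P (s @ [False])])"
  have p: "p 0 = []" "\<And>n. p (Suc n) = p n @ [P (p n @ [False])]"
    by (simp_all add: p_def)
  have "\<not> P (p n)" for n
  proof (induction n)
    case (Suc n)
    then show ?case
      using step[of "p n"] by (cases "P (p n @ [False])") (auto simp: p(2))
  qed (simp add: p neg)
  moreover have "map (\<lambda>n. P (p n @ [False])) [0..<n] = p n" for n
    by (induction n) (simp_all add: p)
  ultimately show False
    using bar[of "\<lambda>n. P (p n @ [False])"] by simp
qed

text \<open>Along every branch the cylinders eventually lie inside \<open>a\<close> or outside it,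
  so \<open>a \<sqinter> cylinder s\<close> becomes a cylinder or \<bottom>. Bar induction then
  reassembles \<open>a\<close> from disjoint halves.\<close>

lemma cantor_alg_induct [case_names bot cylinder disjoint_sup]:
  assumes bot: "P \<bottom>"
    and cyl: "\<And>s. P (cylinder s)"
    and sup: "\<And>a b. a \<sqinter> b = \<bottom> \<Longrightarrow> P a \<Longrightarrow> P b \<Longrightarrow> P (a \<squnion> b)"
  shows "P a"
proof -
  have "P (a \<sqinter> cylinder [])"
  proof (rule bool_list_bar_induct[where P = "\<lambda>s. P (a \<sqinter> cylinder s)"])
    fix x :: "nat \<Rightarrow> bool"
    have a: "open (clopen_set a)" "open (- clopen_set a)"
      using clopen_set[of a] by auto
    show "\<exists>n. P (a \<sqinter> cylinder (map x [0..<n]))"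
    proof (cases "x \<in> clopen_set a")
      case True
      then obtain n where "cylinder_set (map x [0..<n]) \<subseteq> clopen_set a"
        using open_contains_cylinder_set[OF a(1)] by blast
      then have "cylinder (map x [0..<n]) \<le> a"
        by (simp add: less_eq_cantor_alg.rep_eq cylinder.rep_eq)
      then have "a \<sqinter> cylinder (map x [0..<n]) = cylinder (map x [0..<n])"
        by (rule inf.absorb2)
      then show ?thesis
        using cyl by metis
    next
      case False
      then obtain n where "cylinder_set (map x [0..<n]) \<subseteq> - clopen_set a"
        using open_contains_cylinder_set[OF a(2)] by blast
      then have "clopen_set (a \<sqinter> cylinder (map x [0..<n])) = clopen_set \<bottom>"
        by (auto simp: inf_cantor_alg.rep_eq bot_cantor_alg.rep_eq cylinder.rep_eq)
      then show ?thesis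
        using bot by (metis clopen_set_inject)
    qed
  next
    fix s
    assume "P (a \<sqinter> cylinder (s @ [False]))" "P (a \<sqinter> cylinder (s @ [True]))"
    moreover have "(a \<sqinter> cylinder (s @ [False])) \<sqinter> (a \<sqinter> cylinder (s @ [True])) = \<bottom>"
      by transfer (auto simp: cylinder_set_snoc)
    ultimately have "P ((a \<sqinter> cylinder (s @ [False])) \<squnion> (a \<sqinter> cylinder (s @ [True])))"
      by (rule sup[rotated])
    then show "P (a \<sqinter> cylinder s)"
      by (simp add: cylinder_split[of s] inf_sup_distrib1)
  qed
  then show ?thesis by (simp add: cylinder_Nil)
qed

lemma cylinder_le_nonbot:
  assumes "a \<noteq> \<bottom>"
  obtains s where "cylinder s \<le> a"
proof -
  have "clopen_set a \<noteq> {}"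
    using assms by (simp add: bot_cantor_alg.rep_eq flip: clopen_set_inject)
  then obtain x where "x \<in> clopen_set a" by blast
  then obtain n where "cylinder_set (map x [0..<n]) \<subseteq> clopen_set a"
    using open_contains_cylinder_set[of "clopen_set a" x] clopen_set[of a] by auto
  then have "cylinder (map x [0..<n]) \<le> a"
    by (simp add: less_eq_cantor_alg.rep_eq cylinder.rep_eq)
  then show thesis by (rule that)
qed

lemma mem_Sup_fin_cantor_alg:
  assumes "finite P" "P \<noteq> {}"
  shows "x \<in> clopen_set (\<Squnion>\<^sub>f\<^sub>i\<^sub>n P) \<longleftrightarrow> (\<exists>a\<in>P. x \<in> clopen_set a)"
  using assms
proof (induction rule: finite_ne_induct)
  case (insert a P)
  then show ?case by (simp add: sup_cantor_alg.rep_eq)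
qed simp

section \<open>The quantile map\<close>

text \<open>The mass lying lexicographically before the cylinder of \<open>s\<close>: each right
  turn of \<open>s\<close> leaves one whole sibling cylinder on its left.\<close>

definition left_end :: "(cantor_alg \<Rightarrow> real) \<Rightarrow> bool list \<Rightarrow> real" where
  "left_end \<mu> s = (\<Sum>i<length s. if s ! i then \<mu> (cylinder (take i s @ [False])) else 0)"

text \<open>The next bit records whether \<open>t\<close> has reached the split point of the current
  interval. The non-strict comparison gives the split point to the right half, which is why cylinder
  preimages are closed on the left and open on the right.\<close>

primrec quantile_prefix :: "(cantor_alg \<Rightarrow> real) \<Rightarrow> real \<Rightarrow> nat \<Rightarrow> bool list" where
  "quantile_prefix \<mu> t 0 = []"
| "quantile_prefix \<mu> t (Suc n) = quantile_prefix \<mu> t n @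
     [left_end \<mu> (quantile_prefix \<mu> t n) + \<mu> (cylinder (quantile_prefix \<mu> t n @ [False])) \<le> t]"

definition quantile :: "(cantor_alg \<Rightarrow> real) \<Rightarrow> real \<Rightarrow> nat \<Rightarrow> bool" where
  "quantile \<mu> t n \<longleftrightarrow> last (quantile_prefix \<mu> t (Suc n))"

definition line_set :: "(cantor_alg \<Rightarrow> real) \<Rightarrow> cantor_alg \<Rightarrow> real set" where
  "line_set \<mu> a = {t \<in> {0..<1}. quantile \<mu> t \<in> clopen_set a}"

definition line_jordan :: "(cantor_alg \<Rightarrow> real) \<Rightarrow> real set \<Rightarrow> bool" where
  "line_jordan \<mu> A \<longleftrightarrow>
     (\<forall>\<epsilon>>0. \<exists>l u. line_set \<mu> l \<subseteq> A \<and> A \<subseteq> line_set \<mu> u \<and> \<mu> u - \<mu> l < \<epsilon>)"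

text \<open>The same pair of clopen bounds must serve \<open>x\<close> and \<open>A\<close> at once;
  this ties a Cohen element to a set of reals.\<close>

definition sandwiched :: "(cantor_alg \<Rightarrow> real) \<Rightarrow> cohen \<Rightarrow> real set \<Rightarrow> bool" where
  "sandwiched \<mu> x A \<longleftrightarrow>
     (\<forall>\<epsilon>>0. \<exists>l u. cohen_of l \<le> x \<and> x \<le> cohen_of u \<and>
        line_set \<mu> l \<subseteq> A \<and> A \<subseteq> line_set \<mu> u \<and> \<mu> u - \<mu> l < \<epsilon>)"

lemma left_end_Nil: "left_end \<mu> [] = 0"
  by (simp add: left_end_def)

lemma left_end_snoc:
  "left_end \<mu> (s @ [b]) = left_end \<mu> s + (if b then \<mu> (cylinder (s @ [False])) else 0)"
proof -
  have "(\<Sum>i<length s. if (s @ [b]) ! i then \<mu> (cylinder (take i (s @ [b]) @ [False])) else 0) =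
      left_end \<mu> s"
    unfolding left_end_def by (intro sum.cong) (auto simp: nth_append)
  then show ?thesis
    by (simp add: left_end_def)
qed

lemma map_quantile: "map (quantile \<mu> t) [0..<n] = quantile_prefix \<mu> t n"
  by (induction n) (simp_all add: quantile_def)

lemma length_quantile_prefix: "length (quantile_prefix \<mu> t n) = n"
  by (induction n) simp_all

lemma quantile_in_cylinder:
  "quantile \<mu> t \<in> cylinder_set s \<longleftrightarrow> quantile_prefix \<mu> t (length s) = s"
  by (simp add: mem_cylinder_set_iff map_quantile)

lemma line_set_bot: "line_set \<mu> \<bottom> = {}"
  and line_set_top: "line_set \<mu> \<top> = {0..<1}"
  and line_set_compl: "line_set \<mu> (- a) = {0..<1} - line_set \<mu> a"
  and line_set_inf: "line_set \<mu> (a \<sqinter> b) = line_set \<mu> a \<inter> line_set \<mu> b"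
  and line_set_sup: "line_set \<mu> (a \<squnion> b) = line_set \<mu> a \<union> line_set \<mu> b"
  by (auto simp: line_set_def bot_cantor_alg.rep_eq top_cantor_alg.rep_eq
      uminus_cantor_alg.rep_eq inf_cantor_alg.rep_eq sup_cantor_alg.rep_eq)

lemma line_set_subset: "line_set \<mu> a \<subseteq> {0..<1}"
  by (auto simp: line_set_def)

text \<open>Non-atomicity enters in local form: along each branch the cylinder masses become
  arbitrarily small.\<close>

locale nonatomic_positive =
  fixes \<mu> :: "cantor_alg \<Rightarrow> real"
  assumes fin_add: "fin_add_measure \<mu>"
    and positive: "a \<noteq> \<bottom> \<Longrightarrow> 0 < \<mu> a"
    and shrinking: "0 < \<epsilon> \<Longrightarrow> \<exists>n. \<mu> (cylinder (map x [0..<n])) < \<epsilon>"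
begin

section \<open>Quantile preimages as unions of intervals\<close>

lemmas nonneg = fin_add_measure_nonneg[OF fin_add]
lemmas mono = fin_add_measure_mono[OF fin_add]

lemma cylinder_additive:
  "\<mu> (cylinder s) = \<mu> (cylinder (s @ [False])) + \<mu> (cylinder (s @ [True]))"
  unfolding cylinder_split[of s]
  by (rule fin_add_measure_Un[OF fin_add]) (rule cylinder_split_disjoint)

lemma left_end_bounds: "0 \<le> left_end \<mu> s" "left_end \<mu> s + \<mu> (cylinder s) \<le> 1"
proof (induction s rule: rev_induct)
  case Nil
  {
    case 1 show ?case by (simp add: left_end_Nil)
  next
    case 2 show ?case by (simp add: left_end_Nil cylinder_Nil fin_add_measure_top[OF fin_add])
  }
next
  case (snoc b s)
  note additive = cylinder_additive[of s] nonneg[of "cylinder (s @ [False])"]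
    nonneg[of "cylinder (s @ [True])"]
  {
    case 1 show ?case using snoc additive by (simp add: left_end_snoc)
  next
    case 2 show ?case using snoc additive by (cases b) (simp_all add: left_end_snoc)
  }
qed

text \<open>By additivity the two children of \<open>s\<close> divide its interval exactly at the
  point tested by the next bit. The root interval is [0,1), whence the assumption on
  \<open>t\<close>.\<close>

lemma quantile_prefix_eq_iff:
  assumes "t \<in> {0..<1}"
  shows "quantile_prefix \<mu> t (length s) = s \<longleftrightarrow>
    left_end \<mu> s \<le> t \<and> t < left_end \<mu> s + \<mu> (cylinder s)"
proof (induction s rule: rev_induct)
  case Nil
  then show ?case
    using assms by (simp add: left_end_Nil cylinder_Nil fin_add_measure_top[OF fin_add])
next
  case (snoc b s)
  have "quantile_prefix \<mu> t (length (s @ [b])) = s @ [b] \<longleftrightarrow>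
      quantile_prefix \<mu> t (length s) = s \<and>
      b = (left_end \<mu> s + \<mu> (cylinder (s @ [False])) \<le> t)"
    by auto
  then show ?case
    unfolding snoc
    using cylinder_additive[of s] nonneg[of "cylinder (s @ [False])"]
      nonneg[of "cylinder (s @ [True])"]
    by (cases b) (auto simp: left_end_snoc)
qed

lemma line_set_cylinder:
  "line_set \<mu> (cylinder s) = {left_end \<mu> s..<left_end \<mu> s + \<mu> (cylinder s)}"
  using left_end_bounds[of s]
  by (auto simp: line_set_def cylinder.rep_eq quantile_in_cylinder quantile_prefix_eq_iff)

text \<open>Lebesgue measure on the line computes \<mu>, which later makes different measures
  comparable through their line sets.\<close>

lemma emeasure_line_set:
  "line_set \<mu> a \<in> sets lborel \<and> emeasure lborel (line_set \<mu> a) = ennreal (\<mu> a)"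
proof (induction a rule: cantor_alg_induct)
  case bot
  then show ?case by (simp add: line_set_bot fin_add_measure_bot[OF fin_add])
next
  case (cylinder s)
  then show ?case by (simp add: line_set_cylinder nonneg)
next
  case (disjoint_sup a b)
  then have "line_set \<mu> a \<inter> line_set \<mu> b = {}"
    by (metis line_set_inf line_set_bot)
  then show ?case
    using disjoint_sup
    by (auto simp: line_set_sup fin_add_measure_Un[OF fin_add] nonneg ennreal_plus
        simp flip: plus_emeasure)
qed

text \<open>The left siblings passed on the way down to \<open>s\<close> have adjacent intervals
  that fill everything before its left end.\<close>

lemma ex_line_set_initial: "\<exists>l. line_set \<mu> l = {0..<left_end \<mu> s}"
proof (induction s rule: rev_induct)
  case Nil
  show ?case using line_set_bot by (auto simp: left_end_Nil)
next
  case (snoc b s)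
  then obtain l where l: "line_set \<mu> l = {0..<left_end \<mu> s}" by blast
  show ?case
  proof (cases b)
    case True
    have "line_set \<mu> (l \<squnion> cylinder (s @ [False])) = {0..<left_end \<mu> (s @ [b])}"
      using True left_end_bounds(1)[of s] nonneg[of "cylinder (s @ [False])"]
      by (auto simp: line_set_sup l line_set_cylinder left_end_snoc)
    then show ?thesis by blast
  qed (use l in \<open>auto simp: left_end_snoc\<close>)
qed

text \<open>The point \<open>q\<close> lies in the interval of each of its own quantile prefixes.
  Cutting off at the left end of such an interval, or including the whole interval, costs at most
  the mass of the cylinder, which \<open>shrinking\<close> makes small.\<close>

lemma line_jordan_initial:
  assumes "0 \<le> q" "q \<le> 1"
  shows "line_jordan \<mu> {0..<q}"
\<comment> \<open>The value 1 lies outside the domain [0,1) of the quantile map, but there \<top>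
  gives an exact approximation.\<close>
proof (cases "q = 1")
  case True
  then show ?thesis
    unfolding line_jordan_def by (metis line_set_top order_refl diff_self)
next
  case False
  show ?thesis
    unfolding line_jordan_def
  proof (intro allI impI)
    fix \<epsilon> :: real assume "0 < \<epsilon>"
    then obtain n where n: "\<mu> (cylinder (quantile_prefix \<mu> q n)) < \<epsilon>"
      using shrinking[of \<epsilon> "quantile \<mu> q"] by (auto simp: map_quantile)
    define s where "s = quantile_prefix \<mu> q n"
    have q: "left_end \<mu> s \<le> q" "q < left_end \<mu> s + \<mu> (cylinder s)"
      using quantile_prefix_eq_iff[of q s] assms False by (auto simp: s_def length_quantile_prefix)
    obtain l where l: "line_set \<mu> l = {0..<left_end \<mu> s}"
      using ex_line_set_initial by blast
    have "\<mu> (l \<squnion> cylinder s) - \<mu> l < \<epsilon>"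
      using fin_add_measure_subadd[OF fin_add, of l "cylinder s"] n by (simp add: s_def)
    moreover have "{0..<q} \<subseteq> line_set \<mu> (l \<squnion> cylinder s)"
      using q by (auto simp: line_set_sup l line_set_cylinder)
    moreover have "line_set \<mu> l \<subseteq> {0..<q}"
      using q by (auto simp: l)
    ultimately show "\<exists>l u. line_set \<mu> l \<subseteq> {0..<q} \<and> {0..<q} \<subseteq> line_set \<mu> u \<and> \<mu> u - \<mu> l < \<epsilon>"
      by blast
  qed
qed

text \<open>The quantile map may miss points, so this is not a mere preimage argument:
  \<open>a \<sqinter> - b\<close> has empty line set, hence mass 0, and strict positivity makes it
  \<bottom>.\<close>

lemma line_set_subset_imp_le:
  assumes "line_set \<mu> a \<subseteq> line_set \<mu> b"
  shows "a \<le> b"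
proof -
  have "line_set \<mu> (a \<sqinter> - b) = {}"
    using assms by (auto simp: line_set_inf line_set_compl)
  then have "ennreal (\<mu> (a \<sqinter> - b)) = 0"
    using emeasure_line_set[of "a \<sqinter> - b"] by simp
  then have "a \<sqinter> - b = \<bottom>"
    using positive[of "a \<sqinter> - b"] by (auto simp: ennreal_eq_0_iff)
  then show ?thesis by (simp add: inf_shunt)
qed

section \<open>Matching Jordan elements with subsets of the line\<close>

lemma sandwiched_bot: "sandwiched \<mu> \<bottom> {}"
  unfolding sandwiched_def
  by (auto intro!: exI[of _ \<bottom>] simp: cohen_of_hom line_set_bot)

lemma sandwiched_compl:
  assumes "sandwiched \<mu> x A"
  shows "sandwiched \<mu> (- x) ({0..<1} - A)"
  unfolding sandwiched_def
proof (intro allI impI)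
  fix \<epsilon> :: real assume "0 < \<epsilon>"
  then obtain l u where "cohen_of l \<le> x" "x \<le> cohen_of u"
      "line_set \<mu> l \<subseteq> A" "A \<subseteq> line_set \<mu> u" "\<mu> u - \<mu> l < \<epsilon>"
    using assms unfolding sandwiched_def by meson
  then show "\<exists>l u. cohen_of l \<le> - x \<and> - x \<le> cohen_of u \<and> line_set \<mu> l \<subseteq> {0..<1} - A \<and>
      {0..<1} - A \<subseteq> line_set \<mu> u \<and> \<mu> u - \<mu> l < \<epsilon>"
    by (intro exI[of _ "- u"] exI[of _ "- l"])
      (auto simp: cohen_of_hom line_set_compl fin_add_measure_compl[OF fin_add])
qed

lemma sandwiched_inf:
  assumes "sandwiched \<mu> x A" "sandwiched \<mu> y B"
  shows "sandwiched \<mu> (x \<sqinter> y) (A \<inter> B)"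
  unfolding sandwiched_def
proof (intro allI impI)
  fix \<epsilon> :: real assume "0 < \<epsilon>"
  then have "0 < \<epsilon> / 2" by simp
  then obtain l u l' u' where lu: "cohen_of l \<le> x" "x \<le> cohen_of u"
      "line_set \<mu> l \<subseteq> A" "A \<subseteq> line_set \<mu> u" "\<mu> u - \<mu> l < \<epsilon> / 2"
      "cohen_of l' \<le> y" "y \<le> cohen_of u'"
      "line_set \<mu> l' \<subseteq> B" "B \<subseteq> line_set \<mu> u'" "\<mu> u' - \<mu> l' < \<epsilon> / 2"
    using assms unfolding sandwiched_def by meson
  have "l \<le> u" "l' \<le> u'"
    using lu by (meson cohen_of_le_iff order_trans)+
  then have "\<mu> (u \<sqinter> u') - \<mu> (l \<sqinter> l') < \<epsilon>"
    using fin_add_measure_inf_gap[OF fin_add, of l u l' u'] lu by simp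
  then show "\<exists>l u. cohen_of l \<le> x \<sqinter> y \<and> x \<sqinter> y \<le> cohen_of u \<and> line_set \<mu> l \<subseteq> A \<inter> B \<and>
      A \<inter> B \<subseteq> line_set \<mu> u \<and> \<mu> u - \<mu> l < \<epsilon>"
    using lu by (intro exI[of _ "l \<sqinter> l'"] exI[of _ "u \<sqinter> u'"])
      (auto simp: cohen_of_hom line_set_inf intro: le_infI1 le_infI2)
qed

text \<open>Completeness of the Cohen algebra supplies the partner of \<open>A\<close>: the supremum
  of all clopen elements whose line sets lie inside \<open>A\<close>. Clopen elements covering
  \<open>A\<close> bound it because inclusion of line sets reflects the order.\<close>

lemma line_jordan_iff: "line_jordan \<mu> A \<longleftrightarrow> (\<exists>x. sandwiched \<mu> x A)"
proof
  assume A: "line_jordan \<mu> A"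
  define x where "x = Sup {cohen_of l | l. line_set \<mu> l \<subseteq> A}"
  have "cohen_of l \<le> x" if "line_set \<mu> l \<subseteq> A" for l
    unfolding x_def using that by (auto intro: Sup_upper)
  moreover have "x \<le> cohen_of u" if "A \<subseteq> line_set \<mu> u" for u
    unfolding x_def
    by (rule Sup_least) (use that line_set_subset_imp_le in \<open>auto simp: cohen_of_le_iff\<close>)
  ultimately have "sandwiched \<mu> x A"
    using A unfolding line_jordan_def sandwiched_def by meson
  then show "\<exists>x. sandwiched \<mu> x A" ..
qed (unfold line_jordan_def sandwiched_def, meson)

lemma line_jordan_compl: "line_jordan \<mu> A \<Longrightarrow> line_jordan \<mu> ({0..<1} - A)"
  unfolding line_jordan_iff using sandwiched_compl by blast

lemma line_jordan_Int: "line_jordan \<mu> A \<Longrightarrow> line_jordan \<mu> B \<Longrightarrow> line_jordan \<mu> (A \<inter> B)"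
  unfolding line_jordan_iff using sandwiched_inf by blast

text \<open>Replaces the supremum and infimum by single clopen bounds with small gap, the form
  shared with \<open>sandwiched\<close>. Both families of values are nonempty and bounded thanks to
  \<bottom> and \<top>.\<close>

lemma jordan_alg_iff:
  "x \<in> jordan_alg \<mu> \<longleftrightarrow>
    (\<forall>\<epsilon>>0. \<exists>l u. cohen_of l \<le> x \<and> x \<le> cohen_of u \<and> \<mu> u - \<mu> l < \<epsilon>)"
  and inner_ext_ge: "cohen_of l \<le> x \<Longrightarrow> \<mu> l \<le> inner_ext \<mu> x"
  and inner_ext_le: "x \<le> cohen_of u \<Longrightarrow> inner_ext \<mu> x \<le> \<mu> u"
proof -
  let ?L = "{\<mu> b | b. cohen_of b \<le> x}" and ?U = "{\<mu> b | b. x \<le> cohen_of b}"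
  have le: "\<mu> l \<le> \<mu> u" if "cohen_of l \<le> x" "x \<le> cohen_of u" for l u
    using that by (meson mono cohen_of_le_iff order_trans)
  have L: "?L \<noteq> {}" and U: "?U \<noteq> {}"
    using cohen_of_hom(1,2) bot_least[of x] top_greatest[of x]
    by (metis (mono_tags, lifting) empty_iff mem_Collect_eq)+
  have bL: "bdd_above ?L"
    using le[of _ \<top>] by (intro bdd_aboveI[of _ "\<mu> \<top>"]) (auto simp: cohen_of_hom)
  have bU: "bdd_below ?U"
    using nonneg by (intro bdd_belowI[of _ 0]) auto
  show ge: "\<mu> l \<le> inner_ext \<mu> x" if "cohen_of l \<le> x" for l
    unfolding inner_ext_def using that by (auto intro: cSup_upper bL)
  show ub: "inner_ext \<mu> x \<le> \<mu> u" if "x \<le> cohen_of u" for u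
    unfolding inner_ext_def using that by (auto intro!: cSup_least[OF L] le)
  have outer: "outer_ext \<mu> x \<le> \<mu> u" if "x \<le> cohen_of u" for u
    unfolding outer_ext_def using that by (auto intro: cInf_lower bU)
  have inner_outer: "inner_ext \<mu> x \<le> outer_ext \<mu> x"
    unfolding outer_ext_def using ub by (auto intro!: cInf_greatest[OF U])
  show "x \<in> jordan_alg \<mu> \<longleftrightarrow>
    (\<forall>\<epsilon>>0. \<exists>l u. cohen_of l \<le> x \<and> x \<le> cohen_of u \<and> \<mu> u - \<mu> l < \<epsilon>)" (is "_ \<longleftrightarrow> ?R")
  proof
    assume "x \<in> jordan_alg \<mu>"
    then have eq: "Sup ?L = Inf ?U"
      by (simp add: jordan_alg_def inner_ext_def outer_ext_def)
    show ?R
    proof (intro allI impI)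
      fix \<epsilon> :: real assume "0 < \<epsilon>"
      then have "\<exists>r\<in>?L. Sup ?L - \<epsilon> / 2 < r" "\<exists>r\<in>?U. r < Inf ?U + \<epsilon> / 2"
        using less_cSup_iff[OF L bL, of "Sup ?L - \<epsilon> / 2"]
          cInf_less_iff[OF U bU, of "Inf ?U + \<epsilon> / 2"] by auto
      then obtain l u where "cohen_of l \<le> x" "x \<le> cohen_of u"
          "Sup ?L - \<epsilon> / 2 < \<mu> l" "\<mu> u < Inf ?U + \<epsilon> / 2"
        by blast
      then show "\<exists>l u. cohen_of l \<le> x \<and> x \<le> cohen_of u \<and> \<mu> u - \<mu> l < \<epsilon>"
        using eq by (intro exI[of _ l] exI[of _ u]) auto
    qed
  next
    assume R: ?R
    have "outer_ext \<mu> x \<le> inner_ext \<mu> x"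
    proof (rule field_le_epsilon)
      fix \<epsilon> :: real assume "0 < \<epsilon>"
      then obtain l u where "cohen_of l \<le> x" "x \<le> cohen_of u" "\<mu> u - \<mu> l < \<epsilon>"
        using R by blast
      then show "outer_ext \<mu> x \<le> inner_ext \<mu> x + \<epsilon>"
        using ge[of l] outer[of u] by simp
    qed
    then show "x \<in> jordan_alg \<mu>"
      using inner_outer by (simp add: jordan_alg_def)
  qed
qed

text \<open>The counterpart of \<open>line_jordan_iff\<close> with the roles exchanged: the partner
  of \<open>x\<close> is the union of the line sets of all clopen elements below
  \<open>x\<close>.\<close>

lemma ex_sandwiched_iff: "(\<exists>A. sandwiched \<mu> x A) \<longleftrightarrow> x \<in> jordan_alg \<mu>"
proof
  assume x: "x \<in> jordan_alg \<mu>"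
  define A where "A = (\<Union>l\<in>{l. cohen_of l \<le> x}. line_set \<mu> l)"
  have "line_set \<mu> l \<subseteq> A" if "cohen_of l \<le> x" for l
    unfolding A_def using that by auto
  moreover have "A \<subseteq> line_set \<mu> u" if "x \<le> cohen_of u" for u
  proof -
    have "line_set \<mu> l \<subseteq> line_set \<mu> u" if "cohen_of l \<le> x" for l
    proof -
      have "l \<le> u" using that \<open>x \<le> cohen_of u\<close> by (meson cohen_of_le_iff order_trans)
      then show ?thesis by (metis inf.absorb1 inf_le2 line_set_inf)
    qed
    then show ?thesis unfolding A_def by auto
  qed
  ultimately have "sandwiched \<mu> x A"
    using x unfolding jordan_alg_iff sandwiched_def by meson
  then show "\<exists>A. sandwiched \<mu> x A" ..
qed (unfold jordan_alg_iff sandwiched_def, meson)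

end

section \<open>Comparing two measures\<close>

locale nonatomic_positive_pair = \<mu>: nonatomic_positive \<mu> + \<nu>: nonatomic_positive \<nu>
  for \<mu> \<nu> :: "cantor_alg \<Rightarrow> real"
begin

lemma line_set_subset_imp_measure_le:
  assumes "line_set \<mu> a \<subseteq> line_set \<nu> b"
  shows "\<mu> a \<le> \<nu> b"
proof -
  have "emeasure lborel (line_set \<mu> a) \<le> emeasure lborel (line_set \<nu> b)"
    using assms \<nu>.emeasure_line_set by (intro emeasure_mono) auto
  then show ?thesis
    using \<mu>.emeasure_line_set \<nu>.emeasure_line_set \<nu>.nonneg by simp
qed

text \<open>A cylinder interval for \<nu> is a difference of two initial segments, which are Jordan
  for \<mu>. Complements and intersections then give all finite unions.\<close>

lemma line_jordan_line_set: "line_jordan \<mu> (line_set \<nu> a)"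
proof (induction a rule: cantor_alg_induct)
  case bot
  then show ?case
    using \<mu>.line_jordan_initial[of 0] by (simp add: line_set_bot)
next
  case (cylinder s)
  let ?p = "left_end \<nu> s" and ?q = "left_end \<nu> s + \<nu> (cylinder s)"
  have "line_set \<nu> (cylinder s) = {0..<?q} \<inter> ({0..<1} - {0..<?p})"
    using \<nu>.left_end_bounds[of s] by (auto simp: \<nu>.line_set_cylinder)
  moreover have "0 \<le> ?p" "?p \<le> ?q" "?q \<le> 1"
    using \<nu>.left_end_bounds[of s] \<nu>.nonneg[of "cylinder s"] by auto
  ultimately show ?case
    using \<mu>.line_jordan_Int[OF \<mu>.line_jordan_initial \<mu>.line_jordan_compl[OF \<mu>.line_jordan_initial]]
    by simp
next
  case (disjoint_sup a b)
  have "line_set \<nu> (a \<squnion> b) =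
      {0..<1} - (({0..<1} - line_set \<nu> a) \<inter> ({0..<1} - line_set \<nu> b))"
    using line_set_subset[of \<nu> a] line_set_subset[of \<nu> b] by (auto simp: line_set_sup)
  then show ?case
    using disjoint_sup by (simp only: \<mu>.line_jordan_compl \<mu>.line_jordan_Int)
qed

text \<open>The \<nu>-bounds of \<open>A\<close> are themselves Jordan for \<mu>, so the lower one
  can be approximated from inside and the upper one from outside by \<mu>-bounds.\<close>

lemma line_jordan_transfer:
  assumes "line_jordan \<nu> A"
  shows "line_jordan \<mu> A"
  unfolding line_jordan_def
proof (intro allI impI)
  interpret sym: nonatomic_positive_pair \<nu> \<mu> ..
  fix \<epsilon> :: real assume "0 < \<epsilon>"
  then have \<epsilon>: "0 < \<epsilon> / 3" by simp
  then obtain l u where lu: "line_set \<nu> l \<subseteq> A" "A \<subseteq> line_set \<nu> u" "\<nu> u - \<nu> l < \<epsilon> / 3"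
    using assms unfolding line_jordan_def by blast
  obtain l1 u1 where 1: "line_set \<mu> l1 \<subseteq> line_set \<nu> l" "line_set \<nu> l \<subseteq> line_set \<mu> u1"
      "\<mu> u1 - \<mu> l1 < \<epsilon> / 3"
    using line_jordan_line_set[of l] \<epsilon> unfolding line_jordan_def by blast
  obtain l2 u2 where 2: "line_set \<mu> l2 \<subseteq> line_set \<nu> u" "line_set \<nu> u \<subseteq> line_set \<mu> u2"
      "\<mu> u2 - \<mu> l2 < \<epsilon> / 3"
    using line_jordan_line_set[of u] \<epsilon> unfolding line_jordan_def by blast
  \<comment> \<open>The estimate descends through \<open>\<mu> u2\<close>, \<open>\<mu> l2\<close>,
    \<open>\<nu> u\<close>, \<open>\<nu> l\<close>, \<open>\<mu> u1\<close>,
    \<open>\<mu> l1\<close>. The three approximation gaps cost a third of \<epsilon> each; the other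
    two passages come from inclusions of line sets.\<close>
  have "\<mu> u2 - \<mu> l1 < \<epsilon>"
    using line_set_subset_imp_measure_le[OF 2(1)] sym.line_set_subset_imp_measure_le[OF 1(2)]
      lu(3) 1(3) 2(3) by simp
  then show "\<exists>l u. line_set \<mu> l \<subseteq> A \<and> A \<subseteq> line_set \<mu> u \<and> \<mu> u - \<mu> l < \<epsilon>"
    using lu 1 2 by (meson order_trans)
qed

text \<open>A set matched with \<bottom> is covered by line sets of arbitrarily small measure,
  whereas a nonzero \<open>y\<close> contains a clopen element of positive mass by density.\<close>

lemma sandwiched_bot_imp:
  assumes "sandwiched \<mu> \<bottom> A" "sandwiched \<nu> y A"
  shows "y = \<bottom>"
proof (rule ccontr)
  interpret sym: nonatomic_positive_pair \<nu> \<mu> ..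
  assume "y \<noteq> \<bottom>"
  then obtain a where a: "a \<noteq> \<bottom>" "cohen_of a \<le> y"
    by (rule cohen_of_dense)
  \<comment> \<open>Half the mass of \<open>a\<close> bounds each of the two gaps, so that together
    they yield the contradiction \<open>\<nu> a < \<nu> a\<close>.\<close>
  then have "0 < \<nu> a / 2"
    using \<nu>.positive by simp
  then obtain l u l' u' where *: "cohen_of l \<le> \<bottom>" "A \<subseteq> line_set \<mu> u" "\<mu> u - \<mu> l < \<nu> a / 2"
      "y \<le> cohen_of u'" "line_set \<nu> l' \<subseteq> A" "\<nu> u' - \<nu> l' < \<nu> a / 2"
    using assms unfolding sandwiched_def by meson
  have "l = \<bottom>"
    using *(1) by (metis cohen_of_hom(1) cohen_of_inject bot.extremum_uniqueI)
  then have "\<mu> l = 0"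
    by (simp add: fin_add_measure_bot[OF \<mu>.fin_add])
  moreover have "\<nu> l' \<le> \<mu> u"
    using * by (intro sym.line_set_subset_imp_measure_le) auto
  moreover have "\<nu> a \<le> \<nu> u'"
    using a(2) *(4) by (meson \<nu>.mono cohen_of_le_iff order_trans)
  ultimately show False
    using *(3,6) by simp
qed

text \<open>The common set \<open>A\<close> separates a lower \<mu>-bound from an upper \<nu>-bound,
  so their masses compare on the line. Exchanging the measures gives equality of the
  extensions.\<close>

lemma sandwiched_inner_ext_le:
  assumes "sandwiched \<mu> x A" "sandwiched \<nu> y A"
  shows "inner_ext \<mu> x \<le> inner_ext \<nu> y"
proof (rule field_le_epsilon)
  fix \<epsilon> :: real assume "0 < \<epsilon>"
  then have "0 < \<epsilon> / 2" by simp
  then obtain l u l' u' where *: "x \<le> cohen_of u" "line_set \<mu> l \<subseteq> A" "\<mu> u - \<mu> l < \<epsilon> / 2"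
      "cohen_of l' \<le> y" "A \<subseteq> line_set \<nu> u'" "\<nu> u' - \<nu> l' < \<epsilon> / 2"
    using assms unfolding sandwiched_def by meson
  have "\<mu> l \<le> \<nu> u'"
    using * by (intro line_set_subset_imp_measure_le) auto
  then show "inner_ext \<mu> x \<le> inner_ext \<nu> y + \<epsilon>"
    using \<mu>.inner_ext_le[OF *(1)] \<nu>.inner_ext_ge[OF *(4)] *(3,6) by simp
qed

text \<open>Two elements are related when some set of reals is matched with both. Totality on either
  side comes from transferring the Jordan property of that set to the other measure.\<close>

lemma metrically_isomorphic_jordan:
  "metrically_isomorphic (jordan_alg \<mu>) (jordan_ext \<mu>) (jordan_alg \<nu>) (jordan_ext \<nu>)"
proof (rule metrically_isomorphicI_rel[where S = "\<lambda>x y. \<exists>A. sandwiched \<mu> x A \<and> sandwiched \<nu> y A"])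
  interpret sym: nonatomic_positive_pair \<nu> \<mu> ..
  fix x y x' y'
  show "x \<in> jordan_alg \<mu> \<and> y \<in> jordan_alg \<nu> \<and> jordan_ext \<nu> y = jordan_ext \<mu> x"
    if "\<exists>A. sandwiched \<mu> x A \<and> sandwiched \<nu> y A"
  proof -
    from that obtain A where A: "sandwiched \<mu> x A" "sandwiched \<nu> y A" by blast
    then show ?thesis
      using \<mu>.ex_sandwiched_iff[of x] \<nu>.ex_sandwiched_iff[of y]
        sandwiched_inner_ext_le[OF A] sym.sandwiched_inner_ext_le[OF A(2,1)]
      by (auto simp: jordan_ext_def)
  qed
  show "\<exists>y A. sandwiched \<mu> x A \<and> sandwiched \<nu> y A" if "x \<in> jordan_alg \<mu>"
  proof -
    obtain A where "sandwiched \<mu> x A"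
      using \<open>x \<in> jordan_alg \<mu>\<close> \<mu>.ex_sandwiched_iff by blast
    moreover from this have "line_jordan \<nu> A"
      using \<mu>.line_jordan_iff sym.line_jordan_transfer by blast
    ultimately show ?thesis
      using \<nu>.line_jordan_iff by blast
  qed
  show "\<exists>x A. sandwiched \<mu> x A \<and> sandwiched \<nu> y A" if "y \<in> jordan_alg \<nu>"
  proof -
    obtain A where "sandwiched \<nu> y A"
      using \<open>y \<in> jordan_alg \<nu>\<close> \<nu>.ex_sandwiched_iff by blast
    moreover from this have "line_jordan \<mu> A"
      using \<nu>.line_jordan_iff line_jordan_transfer by blast
    ultimately show ?thesis
      using \<mu>.line_jordan_iff by blast
  qed
  show "\<exists>A. sandwiched \<mu> \<bottom> A \<and> sandwiched \<nu> \<bottom> A"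
    using \<mu>.sandwiched_bot \<nu>.sandwiched_bot by blast
  show "y = \<bottom>" if "\<exists>A. sandwiched \<mu> \<bottom> A \<and> sandwiched \<nu> y A"
    using that by (elim exE conjE) (rule sandwiched_bot_imp)
  show "x = \<bottom>" if "\<exists>A. sandwiched \<mu> x A \<and> sandwiched \<nu> \<bottom> A"
    using that by (elim exE conjE) (rule sym.sandwiched_bot_imp)
  show "\<exists>A. sandwiched \<mu> (- x) A \<and> sandwiched \<nu> (- y) A"
    if "\<exists>A. sandwiched \<mu> x A \<and> sandwiched \<nu> y A"
    using that \<mu>.sandwiched_compl \<nu>.sandwiched_compl by blast
  show "\<exists>A. sandwiched \<mu> (x \<sqinter> x') A \<and> sandwiched \<nu> (y \<sqinter> y') A"
    if "\<exists>A. sandwiched \<mu> x A \<and> sandwiched \<nu> y A" "\<exists>A. sandwiched \<mu> x' A \<and> sandwiched \<nu> y' A"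
    using that \<mu>.sandwiched_inf \<nu>.sandwiched_inf by blast
qed

end

section \<open>The given measure and Lebesgue measure as instances\<close>

lemma nonatomic_positiveI:
  assumes "fin_add_measure \<mu>" "strictly_positive \<mu>" "non_atomic \<mu>"
  shows "nonatomic_positive \<mu>"
proof
  show "fin_add_measure \<mu>" by fact
  show "0 < \<mu> a" if "a \<noteq> \<bottom>" for a
    using assms(2) that by (simp add: strictly_positive_def)
  fix \<epsilon> :: real and x :: "nat \<Rightarrow> bool"
  assume "0 < \<epsilon>"
  \<comment> \<open>Non-atomicity only bounds masses non-strictly; halving \<epsilon> yields the
    strict bound.\<close>
  then have "0 < \<epsilon> / 2" by simp
  then obtain P where P: "finite_partition_of_unity P" "\<forall>a\<in>P. \<mu> a \<le> \<epsilon> / 2"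
    using assms(3) unfolding non_atomic_def by meson
  \<comment> \<open>The partition covers the Cantor space, and its member containing
    \<open>x\<close>, being open, contains a whole cylinder around \<open>x\<close>.\<close>
  then obtain a where a: "a \<in> P" "x \<in> clopen_set a"
    using mem_Sup_fin_cantor_alg[of P x]
    by (auto simp: finite_partition_of_unity_def top_cantor_alg.rep_eq)
  obtain n where "cylinder_set (map x [0..<n]) \<subseteq> clopen_set a"
    using open_contains_cylinder_set[of "clopen_set a" x] clopen_set[of a] a(2) by blast
  then have "\<mu> (cylinder (map x [0..<n])) \<le> \<mu> a"
    by (intro fin_add_measure_mono[OF assms(1)])
      (simp add: less_eq_cantor_alg.rep_eq cylinder.rep_eq)
  then show "\<exists>n. \<mu> (cylinder (map x [0..<n])) < \<epsilon>"
    using P(2) a(1) \<open>0 < \<epsilon>\<close> by (intro exI[of _ n]) force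
qed

lemma nonatomic_positive_lebesgue_cantor: "nonatomic_positive lebesgue_cantor"
proof
  show "fin_add_measure lebesgue_cantor"
    by (rule fin_add_measure_lebesgue_cantor)
  show "0 < lebesgue_cantor a" if a: "a \<noteq> \<bottom>" for a
  proof -
    obtain s where "cylinder s \<le> a"
      using a by (rule cylinder_le_nonbot)
    then have "(1/2) ^ length s \<le> lebesgue_cantor a"
      using fin_add_measure_mono[OF fin_add_measure_lebesgue_cantor]
      by (metis lebesgue_cantor_cylinder)
    then show ?thesis
      by (rule less_le_trans[rotated]) simp
  qed
  show "\<exists>n. lebesgue_cantor (cylinder (map x [0..<n])) < \<epsilon>" if "0 < \<epsilon>" for \<epsilon> x
    using real_arch_pow_inv[OF that, of "1/2"] by (simp add: lebesgue_cantor_cylinder)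
qed

theorem theorem4p9:
  fixes \<mu> :: "cantor_alg \<Rightarrow> real"
  assumes "fin_add_measure \<mu>" and "strictly_positive \<mu>" and "non_atomic \<mu>"
  shows "metrically_isomorphic (jordan_alg \<mu>) (jordan_ext \<mu>)
           (jordan_alg lebesgue_cantor) (jordan_ext lebesgue_cantor)"
proof -
  interpret nonatomic_positive_pair \<mu> lebesgue_cantor
    using nonatomic_positiveI[OF assms] nonatomic_positive_lebesgue_cantor
    by (rule nonatomic_positive_pair.intro)
  show ?thesis by (rule metrically_isomorphic_jordan)
qed

end
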